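(* Let $(\Omega,S)$ be an equivalenced scheme such that condition (A) holds for all $u,v\in S^\#$ and condition (B) holds for all $u,v,w\in S^\#$. Let $\alpha_0\in\Omega$. Then the basis relation set of the $\alpha_0$-extension is $$S_{\alpha_0}=S_0(\alpha_0)\cup S_1(\alpha_0).$$ In particular, the $\alpha_0$-extension $(\Omega,S_{\alpha_0})$ is semiregular on $\Omega\setminus\{\alpha_0\}$, and its fibers are exactly the sets $\alpha_0u$, $u\in S$.
   Context: A coherent configuration is a pair $(\Omega,S)$ with $\Omega$ finite and $S$ a partition of $\Omega\times\Omega$ such that the diagonal $1_\Omega$ is a union of elements of $S$, $S$ is closed under $r\mapsto r^*=\{(\beta,\alpha):(\alpha,\beta)\in r\}$, and for $r,s,t\in S$ the number $c_{rs}^t=|\{\beta:(\alpha,\beta)\in r,(\beta,\gamma)\in s\}|$ does not depend on $(\alpha,\gamma)\in t$. A scheme is one with $1_\Omega\in S$; $S^\#=S\setminus\{1_\Omega\}$; $\alpha s=\{\beta:(\alpha,\beta)\in s\}$, $n_s=|\alpha s|$; equivalenced means all $n_s$, $s\in S^\#$, are equal. Fibers of a coherent configuration $(\Omega,T)$ are the sets $\Delta$ with $1_\Delta=\{(\delta,\delta):\delta\in\Delta\}\in T$. For $\alpha\in\Omega$, the $\alpha$-extension $(\Omega,S_\alpha)$ is the coarsest coherent configuration on $\Omega$ such that $\{(\alpha,\alpha)\}$ and every $s\in S$ are unions of its basis relations. It is semiregular on $\Omega\setminus\{\alpha\}$ if $|\{\gamma:(\beta,\gamma)\in s\}|\le1$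 for all $\beta\ne\alpha$ and all $s\in S_\alpha$ with $s\subseteq(\Omega\setminus\{\alpha\})^2$. Composition: $r\cdot s=\{(\alpha,\gamma):\exists\beta,(\alpha,\beta)\in r,(\beta,\gamma)\in s\}$, $X\cdot Y=\{x\cdot y:x\in X,y\in Y\}$; for $r,s\in S$, $rs$ is the set of elements of $S$ contained in $r\cdot s$, and $XY=\bigcup_{x\in X,y\in Y}xy$ for $X,Y\subseteq S$. Splitting set: $D(u,v)=\{w\in S^\#:((uu^* )(vv^* ))\cap ww^*=\{1_\Omega\}\}$. Condition (A) for $u,v$: for all $w,w'\in D(u,v)$, $\bigcap_{a\in\{u,v\},b\in\{w,w'\}}D(a,b)\ne\emptyset$. Condition (B) for $u,v,w$: $D(u,v)\cap D(v,w)\cap D(w,u)\neq\emptyset$. For $u,v\in S$: $S_{\alpha_0}(u,v)=\{s\cap(\alpha_0u\times\alpha_0v):s\in u^*v\}$ and $S_{\alpha_0}(u,v;w)=S_{\alpha_0}(u,w)\cdot S_{\alpha_0}(w,v)$. Define $S_0(\alpha_0)=\bigcup_{u,v\in S^\#}S_{\alpha_0}(u,v;w_{u,v})$ where $w_{u,v}$ is any element of $D(u,v)$ (under (A),(B) this set is nonempty and the result is independent of the choice), and $S_1(\alpha_0)=\{\{\alpha_0\}\times\alpha_0v:v\in S\}\cup\{\alpha_0v\times\{\alpha_0\}:v\in S\}$. *)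

theory Defs
  imports Main
begin

definition is_partition_of :: "('a \<times> 'a) set \<Rightarrow> ('a \<times> 'a) set set \<Rightarrow> bool" where
  "is_partition_of X S \<longleftrightarrow> (\<forall>s\<in>S. s \<noteq> {}) \<and> \<Union>S = X \<and>
     (\<forall>s\<in>S. \<forall>t\<in>S. s \<noteq> t \<longrightarrow> s \<inter> t = {})"

definition union_of :: "('a \<times> 'a) set \<Rightarrow> ('a \<times> 'a) set set \<Rightarrow> bool" where
  "union_of X T \<longleftrightarrow> (\<exists>U\<subseteq>T. \<Union>U = X)"

definition coherent_config :: "'a set \<Rightarrow> ('a \<times> 'a) set set \<Rightarrow> bool" where
  "coherent_config \<Omega> S \<longleftrightarrow>
     finite \<Omega> \<and> is_partition_of (\<Omega> \<times> \<Omega>) S \<and> union_of (Id_on \<Omega>) S \<and>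
     (\<forall>r\<in>S. converse r \<in> S) \<and>
     (\<forall>r\<in>S. \<forall>s\<in>S. \<forall>t\<in>S. \<forall>x\<in>t. \<forall>y\<in>t.
        card {b. (fst x, b) \<in> r \<and> (b, snd x) \<in> s} =
        card {b. (fst y, b) \<in> r \<and> (b, snd y) \<in> s})"

definition scheme :: "'a set \<Rightarrow> ('a \<times> 'a) set set \<Rightarrow> bool" where
  "scheme \<Omega> S \<longleftrightarrow> coherent_config \<Omega> S \<and> Id_on \<Omega> \<in> S"

definition nondiag :: "'a set \<Rightarrow> ('a \<times> 'a) set set \<Rightarrow> ('a \<times> 'a) set set" where
  "nondiag \<Omega> S = S - {Id_on \<Omega>}"

definition equivalenced :: "'a set \<Rightarrow> ('a \<times> 'a) set set \<Rightarrow> bool" where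
  "equivalenced \<Omega> S \<longleftrightarrow>
     (\<exists>k. \<forall>s\<in>nondiag \<Omega> S. \<forall>\<alpha>\<in>\<Omega>. card (s `` {\<alpha>}) = k)"

definition fibers :: "('a \<times> 'a) set set \<Rightarrow> 'a set set" where
  "fibers T = {\<Delta>. Id_on \<Delta> \<in> T}"

definition is_alpha_ext_candidate ::
  "'a set \<Rightarrow> ('a \<times> 'a) set set \<Rightarrow> 'a \<Rightarrow> ('a \<times> 'a) set set \<Rightarrow> bool" where
  "is_alpha_ext_candidate \<Omega> S \<alpha> T \<longleftrightarrow>
     coherent_config \<Omega> T \<and> union_of {(\<alpha>, \<alpha>)} T \<and> (\<forall>s\<in>S. union_of s T)"

definition is_alpha_ext ::
  "'a set \<Rightarrow> ('a \<times> 'a) set set \<Rightarrow> 'a \<Rightarrow> ('a \<times> 'a) set set \<Rightarrow> bool" where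
  "is_alpha_ext \<Omega> S \<alpha> T \<longleftrightarrow> is_alpha_ext_candidate \<Omega> S \<alpha> T \<and>
     (\<forall>T'. is_alpha_ext_candidate \<Omega> S \<alpha> T' \<longrightarrow> (\<forall>t\<in>T. union_of t T'))"

definition alpha_ext :: "'a set \<Rightarrow> ('a \<times> 'a) set set \<Rightarrow> 'a \<Rightarrow> ('a \<times> 'a) set set" where
  "alpha_ext \<Omega> S \<alpha> = (THE T. is_alpha_ext \<Omega> S \<alpha> T)"

definition semiregular_on_minus ::
  "'a set \<Rightarrow> 'a \<Rightarrow> ('a \<times> 'a) set set \<Rightarrow> bool" where
  "semiregular_on_minus \<Omega> \<alpha> T \<longleftrightarrow>
     (\<forall>s\<in>T. s \<subseteq> (\<Omega> - {\<alpha>}) \<times> (\<Omega> - {\<alpha>}) \<longrightarrow>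
        (\<forall>\<beta>. \<beta> \<noteq> \<alpha> \<longrightarrow> card {\<gamma>. (\<beta>, \<gamma>) \<in> s} \<le> 1))"

definition cprod :: "('a \<times> 'a) set set \<Rightarrow> ('a \<times> 'a) set \<Rightarrow> ('a \<times> 'a) set \<Rightarrow> ('a \<times> 'a) set set" where
  "cprod S r s = {t\<in>S. t \<subseteq> r O s}"

definition cprodset :: "('a \<times> 'a) set set \<Rightarrow> ('a \<times> 'a) set set \<Rightarrow> ('a \<times> 'a) set set \<Rightarrow> ('a \<times> 'a) set set" where
  "cprodset S X Y = (\<Union>x\<in>X. \<Union>y\<in>Y. cprod S x y)"

definition splitD :: "'a set \<Rightarrow> ('a \<times> 'a) set set \<Rightarrow> ('a \<times> 'a) set \<Rightarrow> ('a \<times> 'a) set \<Rightarrow> ('a \<times> 'a) set set" where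
  "splitD \<Omega> S u v = {w \<in> nondiag \<Omega> S.
     cprodset S (cprod S u (converse u)) (cprod S v (converse v)) \<inter> cprod S w (converse w)
       = {Id_on \<Omega>}}"

definition condA :: "'a set \<Rightarrow> ('a \<times> 'a) set set \<Rightarrow> ('a \<times> 'a) set \<Rightarrow> ('a \<times> 'a) set \<Rightarrow> bool" where
  "condA \<Omega> S u v \<longleftrightarrow> (\<forall>w\<in>splitD \<Omega> S u v. \<forall>w'\<in>splitD \<Omega> S u v.
     (\<Inter>a\<in>{u, v}. \<Inter>b\<in>{w, w'}. splitD \<Omega> S a b) \<noteq> {})"

definition condB :: "'a set \<Rightarrow> ('a \<times> 'a) set set \<Rightarrow> ('a \<times> 'a) set \<Rightarrow> ('a \<times> 'a) set \<Rightarrow> ('a \<times> 'a) set \<Rightarrow> bool" where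
  "condB \<Omega> S u v w \<longleftrightarrow> splitD \<Omega> S u v \<inter> splitD \<Omega> S v w \<inter> splitD \<Omega> S w u \<noteq> {}"

definition Spair :: "('a \<times> 'a) set set \<Rightarrow> 'a \<Rightarrow> ('a \<times> 'a) set \<Rightarrow> ('a \<times> 'a) set \<Rightarrow> ('a \<times> 'a) set set" where
  "Spair S \<alpha>0 u v = (\<lambda>s. s \<inter> ((u `` {\<alpha>0}) \<times> (v `` {\<alpha>0}))) ` cprod S (converse u) v"

definition Striple :: "('a \<times> 'a) set set \<Rightarrow> 'a \<Rightarrow> ('a \<times> 'a) set \<Rightarrow> ('a \<times> 'a) set \<Rightarrow> ('a \<times> 'a) set \<Rightarrow> ('a \<times> 'a) set set" where
  "Striple S \<alpha>0 u v w = {x O y | x y. x \<in> Spair S \<alpha>0 u w \<and> y \<in> Spair S \<alpha>0 w v}"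

definition S0 :: "'a set \<Rightarrow> ('a \<times> 'a) set set \<Rightarrow> 'a \<Rightarrow> ('a \<times> 'a) set set" where
  "S0 \<Omega> S \<alpha>0 = (\<Union>u\<in>nondiag \<Omega> S. \<Union>v\<in>nondiag \<Omega> S.
     Striple S \<alpha>0 u v (SOME w. w \<in> splitD \<Omega> S u v))"

definition S1 :: "('a \<times> 'a) set set \<Rightarrow> 'a \<Rightarrow> ('a \<times> 'a) set set" where
  "S1 S \<alpha>0 = (\<lambda>v. {\<alpha>0} \<times> (v `` {\<alpha>0})) ` S \<union> (\<lambda>v. (v `` {\<alpha>0}) \<times> {\<alpha>0}) ` S"

end

theory Submission
  imports Defs
begin

text \<open>
  If \<open>uu*\<close> and \<open>ww*\<close> meet only in the diagonal, counting triangles shows that the classes of \<open>S\<close>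
  cut \<open>\<alpha>u \<times> \<alpha>w\<close> into perfect matchings. For \<open>w \<in> D(u,v)\<close> a composite of matchings
  \<open>\<alpha>u \<rightarrow> \<alpha>w \<rightarrow> \<alpha>v\<close> stays inside a single class of \<open>S\<close>. Hence, given \<open>z\<close> in \<open>D(u,w)\<close> and \<open>D(v,w)\<close>
  from condition (A), a matching \<open>\<alpha>u \<rightarrow> \<alpha>w\<close> factors as \<open>a b\<close> through \<open>\<alpha>z\<close> with \<open>a\<close> prescribed,
  and a matching \<open>\<alpha>w \<rightarrow> \<alpha>v\<close> factors as \<open>b\<inverse> c\<close> with the same \<open>b\<close>. So every composite equals
  \<open>a c\<close> with \<open>a\<close> fixed, which shows that the composites partition \<open>\<alpha>u \<times> \<alpha>v\<close> and do not depend
  on \<open>w\<close>. Condition (B) supplies one \<open>w\<close> for three pairs at once, and the same cancellation then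
  gives closure under composition. The resulting partition is therefore coherent, and it is
  coarsest because all its members are obtained from \<open>S\<close> and \<open>{(\<alpha>,\<alpha>)}\<close> by composition,
  converse and intersection.
\<close>

section \<open>Partitions and unions of classes\<close>

lemma partition_eqI:
  assumes "is_partition_of X T" "s \<in> T" "t \<in> T" "p \<in> s" "p \<in> t"
  shows "s = t"
  using assms unfolding is_partition_of_def by blast

lemma partition_cover:
  assumes "is_partition_of X T" "p \<in> X"
  shows "\<exists>t\<in>T. p \<in> t"
  using assms unfolding is_partition_of_def by blast

lemma partition_subset: "is_partition_of X T \<Longrightarrow> t \<in> T \<Longrightarrow> t \<subseteq> X"
  unfolding is_partition_of_def by blast

lemma partition_nonempty: "is_partition_of X T \<Longrightarrow> t \<in> T \<Longrightarrow> t \<noteq> {}"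
  unfolding is_partition_of_def by blast

lemma union_of_subset: "is_partition_of X T \<Longrightarrow> union_of Y T \<Longrightarrow> Y \<subseteq> X"
  unfolding is_partition_of_def union_of_def by blast

lemma union_ofD:
  assumes "is_partition_of X T" "union_of Y T" "t \<in> T" "p \<in> t" "p \<in> Y"
  shows "t \<subseteq> Y"
proof -
  obtain U where U: "U \<subseteq> T" "\<Union>U = Y"
    using assms(2) unfolding union_of_def by blast
  then obtain s where s: "s \<in> U" "p \<in> s"
    using assms(5) by blast
  then have "t = s"
    using partition_eqI[OF assms(1,3)] assms(4) U(1) by blast
  then show ?thesis
    using s U(2) by blast
qed

lemma union_ofI:
  assumes "is_partition_of X T" "Y \<subseteq> X"
    and "\<And>t p. t \<in> T \<Longrightarrow> p \<in> t \<Longrightarrow> p \<in> Y \<Longrightarrow> t \<subseteq> Y"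
  shows "union_of Y T"
proof -
  have "p \<in> \<Union>{t \<in> T. t \<subseteq> Y}" if "p \<in> Y" for p
  proof -
    have "p \<in> X"
      using assms(2) that by blast
    then obtain t where t: "t \<in> T" "p \<in> t"
      using partition_cover[OF assms(1)] by blast
    then have "t \<subseteq> Y"
      using assms(3) that by simp
    then show ?thesis
      using t by blast
  qed
  then have "\<Union>{t \<in> T. t \<subseteq> Y} = Y"
    by blast
  then show ?thesis
    unfolding union_of_def by (intro exI[of _ "{t \<in> T. t \<subseteq> Y}"]) simp
qed

lemma partition_mutual_refinement_subset:
  assumes "is_partition_of X T" "is_partition_of X T'"
    and "\<And>t. t \<in> T \<Longrightarrow> union_of t T'" "\<And>t. t \<in> T' \<Longrightarrow> union_of t T"
  shows "T \<subseteq> T'"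
proof
  fix t assume t: "t \<in> T"
  obtain p where p: "p \<in> t"
    using partition_nonempty[OF assms(1) t] by blast
  then have "p \<in> X"
    using partition_subset[OF assms(1) t] by blast
  then obtain t' where t': "t' \<in> T'" "p \<in> t'"
    using partition_cover[OF assms(2)] by blast
  have "t' = t"
    using union_ofD[OF assms(2) assms(3)[OF t] t' p] union_ofD[OF assms(1) assms(4)[OF t'(1)] t p t'(2)]
    by (rule subset_antisym)
  then show "t \<in> T'"
    using t'(1) by simp
qed

text \<open>This makes the \<open>THE\<close> in \<open>alpha_ext\<close> meaningful: two coarsest
  candidates refine each other, so classes that share a point contain one another.\<close>

lemma is_alpha_ext_unique:
  assumes "is_alpha_ext \<Omega> S \<alpha> T" "is_alpha_ext \<Omega> S \<alpha> T'"
  shows "T = T'"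
proof -
  have part: "is_partition_of (\<Omega> \<times> \<Omega>) T" "is_partition_of (\<Omega> \<times> \<Omega>) T'"
    using assms
    unfolding is_alpha_ext_def is_alpha_ext_candidate_def coherent_config_def by blast+
  have "union_of t T'" if "t \<in> T" for t
    using assms that unfolding is_alpha_ext_def by blast
  moreover have "union_of t T" if "t \<in> T'" for t
    using assms that unfolding is_alpha_ext_def by blast
  ultimately show ?thesis
    using partition_mutual_refinement_subset part by (metis subset_antisym)
qed

section \<open>Coherent configurations\<close>

lemma coherent_config_partition: "coherent_config \<Omega> T \<Longrightarrow> is_partition_of (\<Omega> \<times> \<Omega>) T"
  unfolding coherent_config_def by blast

lemma coherent_config_card_eq:
  assumes "coherent_config \<Omega> T" "r \<in> T" "s \<in> T" "t \<in> T" "(a, c) \<in> t" "(a', c') \<in> t"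
  shows "card {b. (a, b) \<in> r \<and> (b, c) \<in> s} = card {b. (a', b) \<in> r \<and> (b, c') \<in> s}"
proof -
  have "\<forall>x\<in>t. \<forall>y\<in>t. card {b. (fst x, b) \<in> r \<and> (b, snd x) \<in> s} =
        card {b. (fst y, b) \<in> r \<and> (b, snd y) \<in> s}"
    using assms(1-4) unfolding coherent_config_def by blast
  then show ?thesis
    using assms(5,6) by fastforce
qed

text \<open>Membership of a pair in \<open>r O s\<close> says that its number of middle points is
  nonzero, and this number is constant on \<open>t\<close>. Finiteness of \<open>\<Omega>\<close>
  ensures that a nonempty set of middle points has nonzero \<open>card\<close>.\<close>

lemma coherent_config_relcomp_saturated:
  assumes "coherent_config \<Omega> T" "r \<in> T" "s \<in> T" "t \<in> T" "p \<in> t" "p \<in> r O s"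
  shows "t \<subseteq> r O s"
proof
  fix q assume q: "q \<in> t"
  obtain a c where p: "p = (a, c)" by (cases p)
  obtain a' c' where q': "q = (a', c')" by (cases q)
  have "{b. (a, b) \<in> r \<and> (b, c) \<in> s} \<subseteq> \<Omega>"
    using partition_subset[OF coherent_config_partition[OF assms(1)] assms(2)] by blast
  then have "finite {b. (a, b) \<in> r \<and> (b, c) \<in> s}"
    using assms(1) finite_subset unfolding coherent_config_def by blast
  moreover have "{b. (a, b) \<in> r \<and> (b, c) \<in> s} \<noteq> {}"
    using assms(6) p by blast
  ultimately have "card {b. (a, b) \<in> r \<and> (b, c) \<in> s} \<noteq> 0"
    by simp
  then have "card {b. (a', b) \<in> r \<and> (b, c') \<in> s} \<noteq> 0"
    using coherent_config_card_eq[OF assms(1-4), of a c a' c'] assms(5) q p q' by simp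
  then have "{b. (a', b) \<in> r \<and> (b, c') \<in> s} \<noteq> {}"
    by (metis card.empty)
  then show "q \<in> r O s"
    using q' by blast
qed

lemma union_of_member: "t \<in> T \<Longrightarrow> union_of t T"
  unfolding union_of_def by (intro exI[of _ "{t}"]) simp

text \<open>This closure, with those under converse and intersection below, shows that relations
  built from \<open>S\<close> and \<open>{(\<alpha>, \<alpha>)}\<close> are unions of classes of
  every candidate extension.\<close>

lemma union_of_relcomp:
  assumes "coherent_config \<Omega> T" "union_of x T" "union_of y T"
  shows "union_of (x O y) T"
proof (rule union_ofI)
  show P: "is_partition_of (\<Omega> \<times> \<Omega>) T"
    by (rule coherent_config_partition[OF assms(1)])
  show "x O y \<subseteq> \<Omega> \<times> \<Omega>"
    using union_of_subset[OF P assms(2)] union_of_subset[OF P assms(3)] by blast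
  fix t p assume t: "t \<in> T" "p \<in> t" "p \<in> x O y"
  obtain X Y where X: "X \<subseteq> T" "\<Union>X = x" and Y: "Y \<subseteq> T" "\<Union>Y = y"
    using assms(2,3) unfolding union_of_def by blast
  then obtain r s where rs: "r \<in> X" "s \<in> Y" "p \<in> r O s"
    using t(3) by blast
  then have "r \<in> T" "s \<in> T"
    using X(1) Y(1) by auto
  then have "t \<subseteq> r O s"
    using coherent_config_relcomp_saturated[OF assms(1)] t(1,2) rs(3) by simp
  then show "t \<subseteq> x O y"
    using rs(1,2) X(2) Y(2) by blast
qed

lemma union_of_converse:
  assumes "coherent_config \<Omega> T" "union_of x T"
  shows "union_of (x\<inverse>) T"
proof -
  obtain X where X: "X \<subseteq> T" "\<Union>X = x"
    using assms(2) unfolding union_of_def by blast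
  have "converse ` X \<subseteq> T"
    using X assms(1) unfolding coherent_config_def by blast
  moreover have "\<Union>(converse ` X) = x\<inverse>"
    using X by blast
  ultimately show ?thesis
    unfolding union_of_def by blast
qed

lemma union_of_Int:
  assumes "coherent_config \<Omega> T" "union_of x T" "union_of y T"
  shows "union_of (x \<inter> y) T"
proof (rule union_ofI)
  show P: "is_partition_of (\<Omega> \<times> \<Omega>) T"
    by (rule coherent_config_partition[OF assms(1)])
  show "x \<inter> y \<subseteq> \<Omega> \<times> \<Omega>"
    using union_of_subset[OF P assms(2)] by blast
  show "t \<subseteq> x \<inter> y" if "t \<in> T" "p \<in> t" "p \<in> x \<inter> y" for t p
    using union_ofD[OF P assms(2)] union_ofD[OF P assms(3)] that by simp
qed

section \<open>Matchings\<close>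

text \<open>Bijections are kept as relations with exact domain and range, so that \<open>O\<close>
  and converse serve as composition and inverse without choosing functions.\<close>

definition matching :: "('a \<times> 'a) set \<Rightarrow> 'a set \<Rightarrow> 'a set \<Rightarrow> bool" where
  "matching x A B \<longleftrightarrow>
     Domain x = A \<and> Range x = B \<and> single_valued x \<and> single_valued (x\<inverse>)"

lemma matching_converse: "matching x A B \<Longrightarrow> matching (x\<inverse>) B A"
  unfolding matching_def by simp

lemma matching_subset: "matching x A B \<Longrightarrow> x \<subseteq> A \<times> B"
  unfolding matching_def by auto

lemma matching_unique:
  assumes "matching x A B"
  shows "(a, b) \<in> x \<Longrightarrow> (a, b') \<in> x \<Longrightarrow> b = b'"
    and "(a, b) \<in> x \<Longrightarrow> (a', b) \<in> x \<Longrightarrow> a = a'"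
  using assms unfolding matching_def single_valued_def by simp_all

lemma matching_total:
  assumes "matching x A B"
  shows "a \<in> A \<Longrightarrow> \<exists>b\<in>B. (a, b) \<in> x"
    and "b \<in> B \<Longrightarrow> \<exists>a\<in>A. (a, b) \<in> x"
  using assms unfolding matching_def by auto

lemma matching_relcomp:
  assumes "matching x A B" "matching y B C"
  shows "matching (x O y) A C"
  unfolding matching_def
proof (intro conjI)
  show "Domain (x O y) = A"
    using matching_total(1)[OF assms(1)] matching_total(1)[OF assms(2)] matching_subset[OF assms(1)]
    by fast
  show "Range (x O y) = C"
    using matching_total(2)[OF assms(1)] matching_total(2)[OF assms(2)] matching_subset[OF assms(2)]
    by fast
qed (use assms in \<open>auto simp: matching_def single_valued_relcomp converse_relcomp\<close>)

text \<open>The graph of a function contains no smaller graph with the same domain, so inclusions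
  between matchings become equalities without counting.\<close>

lemma matching_subset_eq:
  assumes "matching x A B" "matching y A B" "x \<subseteq> y"
  shows "x = y"
proof
  show "y \<subseteq> x"
  proof
    fix p assume p: "p \<in> y"
    obtain a b where ab: "p = (a, b)" by (cases p)
    then have "a \<in> A"
      using p matching_subset[OF assms(2)] by blast
    then obtain b' where b': "(a, b') \<in> x"
      using matching_total[OF assms(1)] by blast
    then have "b = b'"
      using matching_unique(1)[OF assms(2)] assms(3) p ab by blast
    then show "p \<in> x"
      using b' ab by simp
  qed
qed (rule assms)

lemma matching_relcomp_converse:
  assumes "matching x A B"
  shows "x O x\<inverse> = Id_on A" "x\<inverse> O x = Id_on B"
proof -
  have *: "x O x\<inverse> = Id_on A" if "matching x A B" for x :: "('a \<times> 'a) set" and A B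
    using matching_unique(2)[OF that] matching_total(1)[OF that] matching_subset[OF that] by fast
  show "x O x\<inverse> = Id_on A"
    using *[OF assms] .
  show "x\<inverse> O x = Id_on B"
    using *[OF matching_converse[OF assms]] by simp
qed

section \<open>The neighbourhoods of a point in a scheme\<close>

locale pointed_scheme =
  fixes \<Omega> :: "'a set" and S :: "('a \<times> 'a) set set" and \<alpha> :: 'a
  assumes scheme: "scheme \<Omega> S" and point: "\<alpha> \<in> \<Omega>"
begin

abbreviation nbh :: "('a \<times> 'a) set \<Rightarrow> 'a set" where
  "nbh u \<equiv> u `` {\<alpha>}"

lemma config: "coherent_config \<Omega> S"
  using scheme unfolding scheme_def by blast

lemma diag_in: "Id_on \<Omega> \<in> S"
  using scheme unfolding scheme_def by blast

lemmas part = coherent_config_partition[OF config]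

lemmas saturated = coherent_config_relcomp_saturated[OF config]

lemma fin: "finite \<Omega>"
  using config unfolding coherent_config_def by blast

lemma conv: "u \<in> S \<Longrightarrow> u\<inverse> \<in> S"
  using config unfolding coherent_config_def by blast

lemma in_\<Omega>:
  assumes "u \<in> S" "(a, b) \<in> u"
  shows "a \<in> \<Omega>" "b \<in> \<Omega>"
  using partition_subset[OF part assms(1)] assms(2) by blast+

lemma class_of:
  assumes "a \<in> \<Omega>" "b \<in> \<Omega>"
  shows "\<exists>s\<in>S. (a, b) \<in> s"
  using partition_cover[OF part] assms by blast

lemma nondiagD:
  assumes "u \<in> nondiag \<Omega> S"
  shows "u \<in> S" "u \<noteq> Id_on \<Omega>"
  using assms unfolding nondiag_def by auto

lemma nondiag_converse:
  assumes "u \<in> nondiag \<Omega> S"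
  shows "u\<inverse> \<in> nondiag \<Omega> S"
proof -
  have "u\<inverse> \<noteq> Id_on \<Omega>"
    using nondiagD(2)[OF assms] by (metis converse_Id_on converse_converse)
  then show ?thesis
    using conv nondiagD(1)[OF assms] unfolding nondiag_def by blast
qed

text \<open>The valency at a point counts the closed walks of length two over \<open>s\<close> and
  its converse, which is an intersection number of the diagonal class.\<close>

lemma valency_eq:
  assumes "s \<in> S" "a \<in> \<Omega>" "b \<in> \<Omega>"
  shows "card (s `` {a}) = card (s `` {b})"
proof -
  have "{c. (x, c) \<in> s \<and> (c, x) \<in> s\<inverse>} = s `` {x}" for x
    by blast
  then show ?thesis
    using coherent_config_card_eq[OF config assms(1) conv[OF assms(1)] diag_in, of a a b b] assms
    by auto
qed

lemma nbh_nonempty: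
  assumes "s \<in> S" "a \<in> \<Omega>"
  shows "s `` {a} \<noteq> {}"
proof -
  obtain x y where xy: "(x, y) \<in> s"
    using partition_nonempty[OF part assms(1)] by auto
  have "finite (s `` {x})"
    using in_\<Omega>[OF assms(1)] fin by (meson Image_singleton_iff finite_subset subsetI)
  then have "card (s `` {x}) \<noteq> 0"
    using xy by auto
  then show ?thesis
    using valency_eq[OF assms(1,2) in_\<Omega>(1)[OF assms(1) xy]] by auto
qed

lemma nbh_diag: "nbh (Id_on \<Omega>) = {\<alpha>}"
  using point by blast

lemma nbh_eqI:
  assumes "u \<in> S" "v \<in> S" "b \<in> nbh u" "b \<in> nbh v"
  shows "u = v"
  using partition_eqI[OF part assms(1,2)] assms(3,4) by blast

lemma nbh_subset: "u \<in> S \<Longrightarrow> nbh u \<subseteq> \<Omega>"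
  using in_\<Omega> by blast

lemma nbh_cover:
  assumes "b \<in> \<Omega>"
  shows "\<exists>u\<in>S. b \<in> nbh u"
  using class_of[OF point assms] by blast

text \<open>By saturation a single triangle puts the whole class \<open>s\<close> inside
  \<open>u O v\<close>; this turns pointwise walks into statements about products of
  classes.\<close>

lemma in_cprod:
  assumes "u \<in> S" "v \<in> S" "s \<in> S" "(a, b) \<in> u" "(b, c) \<in> v" "(a, c) \<in> s"
  shows "s \<in> cprod S u v"
  using saturated[OF assms(1-3), of "(a, c)"] assms unfolding cprod_def by blast

lemma Spair_subset: "x \<in> Spair S \<alpha> u v \<Longrightarrow> x \<subseteq> nbh u \<times> nbh v"
  unfolding Spair_def by blast

lemma Spair_cover:
  assumes "u \<in> S" "v \<in> S" "b \<in> nbh u" "c \<in> nbh v"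
  shows "\<exists>x \<in> Spair S \<alpha> u v. (b, c) \<in> x"
proof -
  obtain s where s: "s \<in> S" "(b, c) \<in> s"
    using class_of assms nbh_subset by blast
  have "s \<in> cprod S (u\<inverse>) v"
    using in_cprod[OF conv[OF assms(1)] assms(2) s(1)] s assms by blast
  then show ?thesis
    using s assms unfolding Spair_def by (intro bexI[of _ "s \<inter> (nbh u \<times> nbh v)"]) auto
qed

lemma Spair_eqI:
  assumes "x \<in> Spair S \<alpha> u v" "y \<in> Spair S \<alpha> u v" "p \<in> x" "p \<in> y"
  shows "x = y"
proof -
  obtain s t where "x = s \<inter> (nbh u \<times> nbh v)" "y = t \<inter> (nbh u \<times> nbh v)" "s \<in> S" "t \<in> S"
    using assms(1,2) unfolding Spair_def cprod_def by blast
  then show ?thesis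
    using partition_eqI[OF part, of s t p] assms(3,4) by blast
qed

lemma Spair_converse:
  assumes "x \<in> Spair S \<alpha> u v"
  shows "x\<inverse> \<in> Spair S \<alpha> v u"
proof -
  obtain s where s: "s \<in> S" "s \<subseteq> u\<inverse> O v" "x = s \<inter> (nbh u \<times> nbh v)"
    using assms unfolding Spair_def cprod_def by blast
  have "s\<inverse> \<in> cprod S (v\<inverse>) u"
    using conv s(1,2) unfolding cprod_def by blast
  moreover have "x\<inverse> = s\<inverse> \<inter> (nbh v \<times> nbh u)"
    using s by blast
  ultimately show ?thesis
    unfolding Spair_def by blast
qed

text \<open>Pointwise form of \<open>uu* \<inter> ww* = {1}\<close>.\<close>

definition splits :: "('a \<times> 'a) set \<Rightarrow> ('a \<times> 'a) set \<Rightarrow> bool" where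
  "splits u w \<longleftrightarrow> (\<forall>a a' b c. (a, b) \<in> u \<longrightarrow> (a', b) \<in> u \<longrightarrow> (a, c) \<in> w \<longrightarrow> (a', c) \<in> w \<longrightarrow> a = a')"

lemma splits_sym: "splits u w \<Longrightarrow> splits w u"
  unfolding splits_def by blast

text \<open>The walk \<open>a, b, a', c, a''\<close> places the class of \<open>(a, a'')\<close> in
  the product of \<open>uu*\<close> with \<open>vv*\<close>, while the walk through \<open>d\<close>
  places it in \<open>ww*\<close>. By the choice of \<open>w\<close> that class is the
  diagonal.\<close>

lemma splitD_path_eq:
  assumes "w \<in> splitD \<Omega> S u v" "u \<in> S" "v \<in> S"
    and "(a, b) \<in> u" "(a', b) \<in> u" "(a', c) \<in> v" "(a'', c) \<in> v" "(a, d) \<in> w" "(a'', d) \<in> w"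
  shows "a = a''"
proof -
  have w: "w \<in> S"
    using assms(1) nondiagD(1) unfolding splitD_def by blast
  have \<Omega>: "a \<in> \<Omega>" "a' \<in> \<Omega>" "a'' \<in> \<Omega>"
    using assms in_\<Omega> w by blast+
  obtain q where q: "q \<in> S" "(a, a') \<in> q"
    using class_of \<Omega> by blast
  obtain r where r: "r \<in> S" "(a', a'') \<in> r"
    using class_of \<Omega> by blast
  obtain t where t: "t \<in> S" "(a, a'') \<in> t"
    using class_of \<Omega> by blast
  have "q \<in> cprod S u (u\<inverse>)"
    using in_cprod[OF assms(2) conv[OF assms(2)] q(1)] q assms by blast
  moreover have "r \<in> cprod S v (v\<inverse>)"
    using in_cprod[OF assms(3) conv[OF assms(3)] r(1)] r assms by blast
  moreover have "t \<in> cprod S q r"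
    using in_cprod[OF q(1) r(1) t(1)] q r t by blast
  moreover have "t \<in> cprod S w (w\<inverse>)"
    using in_cprod[OF w conv[OF w] t(1)] t assms by blast
  ultimately have "t \<in> {Id_on \<Omega>}"
    using assms(1) unfolding splitD_def cprodset_def by blast
  then show ?thesis
    using t by blast
qed

text \<open>Both parts are degenerate cases of \<open>splitD_path_eq\<close> in which one of the two
  detours returns to its starting point; the neighbour visited by that detour exists because no
  neighbourhood is empty.\<close>

lemma splitD_splits:
  assumes "w \<in> splitD \<Omega> S u v" "u \<in> S" "v \<in> S"
  shows "splits u w" "splits v w"
proof -
  show "splits u w"
    unfolding splits_def
  proof (intro allI impI)
    fix a a' b c assume h: "(a, b) \<in> u" "(a', b) \<in> u" "(a, c) \<in> w" "(a', c) \<in> w"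
    obtain d where "(a', d) \<in> v"
      using nbh_nonempty[OF assms(3)] in_\<Omega>(1)[OF assms(2) h(2)] by blast
    then show "a = a'"
      using splitD_path_eq[OF assms h(1,2)] h(3,4) by blast
  qed
  show "splits v w"
    unfolding splits_def
  proof (intro allI impI)
    fix a a' b c assume h: "(a, b) \<in> v" "(a', b) \<in> v" "(a, c) \<in> w" "(a', c) \<in> w"
    obtain d where "(a, d) \<in> u"
      using nbh_nonempty[OF assms(2)] in_\<Omega>(1)[OF assms(3) h(1)] by blast
    then show "a = a'"
      using splitD_path_eq[OF assms] h by blast
  qed
qed

lemma splitD_in:
  assumes "w \<in> splitD \<Omega> S u v"
  shows "w \<in> nondiag \<Omega> S" "w \<in> S"
  using assms nondiagD(1) unfolding splitD_def by blast+

text \<open>A path \<open>b, d, c\<close> over \<open>x\<close> and \<open>y\<close> that is closed by \<open>p\<close> can be transported to any other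
  edge of \<open>x\<close> by coherence, and the splitting property forces the transported end point to
  lie in \<open>nbh v\<close>.\<close>

lemma Spair_relcomp_subset_class_aux:
  assumes w: "w \<in> splitD \<Omega> S u v" and u: "u \<in> S" and v: "v \<in> S"
    and x: "x \<in> Spair S \<alpha> u w" and y: "y \<in> Spair S \<alpha> w v"
    and fn: "\<And>d c c'. (d, c) \<in> y \<Longrightarrow> (d, c') \<in> y \<Longrightarrow> c = c'"
    and p: "p \<in> S" "(b, c) \<in> x O y" "(b, c) \<in> p"
  shows "x O y \<subseteq> p"
proof
  fix q assume "q \<in> x O y"
  then obtain b' d' c' where q: "q = (b', c')" "(b', d') \<in> x" "(d', c') \<in> y"
    by blast
  obtain d where d: "(b, d) \<in> x" "(d, c) \<in> y"
    using p by blast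
  obtain s where s: "s \<in> S" "x = s \<inter> (nbh u \<times> nbh w)"
    using x unfolding Spair_def cprod_def by blast
  obtain t where t: "t \<in> S" "t \<subseteq> w\<inverse> O v" "y = t \<inter> (nbh w \<times> nbh v)"
    using y unfolding Spair_def cprod_def by blast
  have pc: "p \<in> cprod S (u\<inverse>) v"
    using in_cprod[OF conv[OF u] v p(1)] p(3) d s(2) t(3) by blast
  have "s \<subseteq> p O t\<inverse>"
    using saturated[OF p(1) conv[OF t(1)] s(1), of "(b, d)"] p(3) d s(2) t(3) by blast
  then obtain e where e: "(b', e) \<in> p" "(d', e) \<in> t"
    using q(2) s(2) by blast
  obtain a' where a': "(a', b') \<in> u" "(a', e) \<in> v"
    using e(1) pc unfolding cprod_def by blast
  obtain a'' where a'': "(a'', d') \<in> w" "(a'', e) \<in> v"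
    using e(2) t(2) by blast
  \<comment> \<open>The walk \<open>\<alpha>, b', a', e, a''\<close> uses \<open>u\<close> twice and
    then \<open>v\<close> twice, and \<open>\<alpha>, d', a''\<close> uses \<open>w\<close> twice,
    so the splitting property identifies the two ends and puts \<open>e\<close> into
    \<open>nbh v\<close>.\<close>
  have "\<alpha> = a''"
    using splitD_path_eq[OF w u v _ a'(1,2) a''(2) _ a''(1)] q(2) s(2) by blast
  then have "(d', e) \<in> y"
    using a'' e(2) t(3) by blast
  then show "q \<in> p"
    using fn[OF q(3)] e(1) q(1) by blast
qed

end


section \<open>Equivalenced schemes\<close>

locale equivalenced_pointed_scheme = pointed_scheme +
  assumes equivalenced: "equivalenced \<Omega> S"
begin

text \<open>Counting the triangles over the edge classes \<open>u, w, s\<close> with a fixed vertex \<open>b\<close>: the splitting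
  property makes the apex unique for each \<open>s\<close>-neighbour of \<open>b\<close>, and equal valencies then force
  each apex to contribute exactly one triangle.\<close>

lemma card_common_neighbours:
  assumes u: "u \<in> nondiag \<Omega> S" and w: "w \<in> nondiag \<Omega> S" and "splits u w"
    and s: "s \<in> cprod S (u\<inverse>) w" and ab: "(a, b) \<in> u"
  shows "card {c. (a, c) \<in> w \<and> (b, c) \<in> s} = 1"
proof -
  define d where "d = card {c. (a, c) \<in> w \<and> (b, c) \<in> s}"
  define P where "P = Sigma (u\<inverse> `` {b}) (\<lambda>a'. {c. (a', c) \<in> w \<and> (b, c) \<in> s})"
  have uS: "u \<in> S" and wS: "w \<in> S" and sS: "s \<in> S" and sub: "s \<subseteq> u\<inverse> O w"
    using u w s nondiagD(1) unfolding cprod_def by auto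
  have b: "b \<in> \<Omega>"
    using in_\<Omega>(2)[OF uS ab] .
  obtain k where k: "\<forall>s\<in>nondiag \<Omega> S. \<forall>\<alpha>\<in>\<Omega>. card (s `` {\<alpha>}) = k"
    using equivalenced unfolding equivalenced_def by blast
  have ku: "card (u\<inverse> `` {b}) = k"
    using k nondiag_converse[OF u] b by blast
  have finu: "finite (u\<inverse> `` {b})"
    using fin in_\<Omega>(1)[OF uS] by (auto intro: finite_subset)
  have "k > 0"
    using ku finu ab by (auto simp: card_gt_0_iff)
  \<comment> \<open>With \<open>s\<close> reversed, this count is an intersection number of the
    class \<open>u\<close>, hence the same for every apex \<open>a'\<close>.\<close>
  have "card {c. (a', c) \<in> w \<and> (b, c) \<in> s} = d" if "(a', b) \<in> u" for a'
    using coherent_config_card_eq[OF config wS conv[OF sS] uS that ab] unfolding d_def by simp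
  moreover have "finite {c. (a', c) \<in> w \<and> (b, c) \<in> s}" for a'
    using fin in_\<Omega>(2)[OF wS] by (auto intro: finite_subset)
  ultimately have "card P = k * d"
    unfolding P_def using finu ku by (subst card_SigmaI) auto
  moreover have "inj_on snd P"
    using \<open>splits u w\<close> unfolding inj_on_def P_def splits_def by fastforce
  moreover have "snd ` P = s `` {b}"
    using sub unfolding P_def by force
  ultimately have kd: "card (s `` {b}) = k * d"
    by (metis card_image)
  show ?thesis
  \<comment> \<open>The common valency \<open>k\<close> says nothing about the diagonal, whose
    valency is 1; there \<open>k * d = 1\<close> still forces \<open>d = 1\<close>.\<close>
  proof (cases "s = Id_on \<Omega>")
    case True
    then have "s `` {b} = {b}"
      using b by blast
    then have "k * d = 1"
      using kd by simp
    then show ?thesis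
      unfolding d_def by simp
  next
    case False
    then have "card (s `` {b}) = k"
      using k sS b unfolding nondiag_def by blast
    then show ?thesis
      using kd \<open>k > 0\<close> unfolding d_def by simp
  qed
qed

text \<open>This is the triangle count with apex \<open>\<alpha>\<close>: every \<open>b\<close> in
  \<open>nbh u\<close> has exactly one partner in \<open>nbh w\<close>. Applied to the converse as
  well, it yields \<open>Spair_matching\<close>.\<close>

lemma Spair_functional:
  assumes "u \<in> nondiag \<Omega> S" "w \<in> nondiag \<Omega> S" "splits u w" "x \<in> Spair S \<alpha> u w"
  shows "Domain x = nbh u" "single_valued x"
proof -
  obtain s where s: "s \<in> cprod S (u\<inverse>) w" "x = s \<inter> (nbh u \<times> nbh w)"
    using assms(4) unfolding Spair_def by blast
  have *: "\<exists>c. {c. (\<alpha>, c) \<in> w \<and> (b, c) \<in> s} = {c}" if "b \<in> nbh u" for b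
    using card_common_neighbours[OF assms(1-3) s(1)] that by (simp add: card_1_singleton_iff)
  show "Domain x = nbh u"
  proof
    show "Domain x \<subseteq> nbh u"
      using s(2) by blast
    show "nbh u \<subseteq> Domain x"
    proof
      fix b assume b: "b \<in> nbh u"
      then obtain c where "c \<in> {c. (\<alpha>, c) \<in> w \<and> (b, c) \<in> s}"
        using * by blast
      then show "b \<in> Domain x"
        using b s(2) by auto
    qed
  qed
  show "single_valued x"
  proof (rule single_valuedI)
    fix b c c' assume h: "(b, c) \<in> x" "(b, c') \<in> x"
    then have "b \<in> nbh u" and m: "c \<in> {c. (\<alpha>, c) \<in> w \<and> (b, c) \<in> s}"
      "c' \<in> {c. (\<alpha>, c) \<in> w \<and> (b, c) \<in> s}"
      using s(2) by auto
    then obtain e where "{c. (\<alpha>, c) \<in> w \<and> (b, c) \<in> s} = {e}"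
      using * by blast
    then show "c = c'"
      using m by simp
  qed
qed

lemma Spair_matching:
  assumes "u \<in> nondiag \<Omega> S" "w \<in> nondiag \<Omega> S" "splits u w" "x \<in> Spair S \<alpha> u w"
  shows "matching x (nbh u) (nbh w)"
  using Spair_functional[OF assms]
    Spair_functional[OF assms(2,1) splits_sym[OF assms(3)] Spair_converse[OF assms(4)]]
  unfolding matching_def by simp

lemma splitD_Spair_matching:
  assumes "u \<in> nondiag \<Omega> S" "v \<in> nondiag \<Omega> S" "w \<in> splitD \<Omega> S u v"
  shows "x \<in> Spair S \<alpha> u w \<Longrightarrow> matching x (nbh u) (nbh w)"
    and "x \<in> Spair S \<alpha> w v \<Longrightarrow> matching x (nbh w) (nbh v)"
  using Spair_matching splitD_splits[OF assms(3)] splitD_in(1)[OF assms(3)] assms(1,2)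
    nondiagD(1) splits_sym by simp_all

lemma nbh_ex: "u \<in> nondiag \<Omega> S \<Longrightarrow> \<exists>b. b \<in> nbh u"
  using nbh_nonempty[OF _ point] nondiagD(1) by blast

lemma Spair_nonempty:
  assumes "u \<in> nondiag \<Omega> S" "v \<in> nondiag \<Omega> S"
  shows "\<exists>x. x \<in> Spair S \<alpha> u v"
  using nbh_ex[OF assms(1)] nbh_ex[OF assms(2)]
    Spair_cover[OF nondiagD(1)[OF assms(1)] nondiagD(1)[OF assms(2)]] by blast

lemma Spair_relcomp_subset_class:
  assumes "u \<in> nondiag \<Omega> S" "v \<in> nondiag \<Omega> S" "w \<in> splitD \<Omega> S u v"
    and "x \<in> Spair S \<alpha> u w" "y \<in> Spair S \<alpha> w v"
    and "p \<in> S" "(b, c) \<in> x O y" "(b, c) \<in> p"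
  shows "x O y \<subseteq> p"
  using Spair_relcomp_subset_class_aux[OF assms(3) nondiagD(1)[OF assms(1)] nondiagD(1)[OF assms(2)] assms(4,5)
      _ assms(6-8)] matching_unique(1)[OF splitD_Spair_matching(2)[OF assms(1-3,5)]] by blast

section \<open>Factoring matchings through a third neighbourhood\<close>

context
  fixes u w z
  assumes u: "u \<in> nondiag \<Omega> S" and w: "w \<in> nondiag \<Omega> S" and uw: "splits u w"
    and z: "z \<in> splitD \<Omega> S u w"
begin

text \<open>The composite stays inside one class of \<open>S\<close>, hence inside one member
  \<open>q\<close> of \<open>Spair S \<alpha> u w\<close>; since both are matchings, they
  coincide.\<close>

lemma Spair_relcomp:
  assumes x: "x \<in> Spair S \<alpha> u z" and y: "y \<in> Spair S \<alpha> z w"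
  shows "x O y \<in> Spair S \<alpha> u w"
proof -
  have m: "matching (x O y) (nbh u) (nbh w)"
    using matching_relcomp splitD_Spair_matching[OF u w z] x y by blast
  obtain b c where bc: "b \<in> nbh u" "c \<in> nbh w" "(b, c) \<in> x O y"
    using nbh_ex[OF u] matching_total(1)[OF m] by blast
  obtain q where q: "q \<in> Spair S \<alpha> u w" "(b, c) \<in> q"
    using Spair_cover[OF nondiagD(1)[OF u] nondiagD(1)[OF w] bc(1,2)] by blast
  then obtain p where p: "p \<in> S" "q = p \<inter> (nbh u \<times> nbh w)"
    unfolding Spair_def cprod_def by blast
  have "x O y \<subseteq> p"
    using Spair_relcomp_subset_class[OF u w z x y p(1) bc(3)] q(2) p(2) by blast
  then have "x O y \<subseteq> q"
    using matching_subset[OF m] p(2) by blast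
  then have "x O y = q"
    using matching_subset_eq[OF m Spair_matching[OF u w uw q(1)]] by blast
  then show ?thesis
    using q(1) by simp
qed

text \<open>The factor \<open>b\<close> is chosen to fit one edge of \<open>x\<close>. As
  \<open>a O b\<close> again belongs to \<open>Spair S \<alpha> u w\<close>, agreement at that edge
  gives equality.\<close>

lemma Spair_factor_left:
  assumes a: "a \<in> Spair S \<alpha> u z" and x: "x \<in> Spair S \<alpha> u w"
  shows "\<exists>b\<in>Spair S \<alpha> z w. x = a O b"
proof -
  obtain i where i: "i \<in> nbh u"
    using nbh_ex[OF u] by blast
  obtain j where j: "j \<in> nbh w" "(i, j) \<in> x"
    using matching_total(1)[OF Spair_matching[OF u w uw x] i] by blast
  obtain l where l: "l \<in> nbh z" "(i, l) \<in> a"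
    using matching_total(1)[OF splitD_Spair_matching(1)[OF u w z a] i] by blast
  obtain b where b: "b \<in> Spair S \<alpha> z w" "(l, j) \<in> b"
    using Spair_cover[OF splitD_in(2)[OF z] nondiagD(1)[OF w] l(1) j(1)] by blast
  have "(i, j) \<in> a O b"
    using l(2) b(2) by blast
  then have "x = a O b"
    using Spair_eqI[OF x Spair_relcomp[OF a b(1)] j(2)] by blast
  then show ?thesis
    using b(1) by blast
qed

lemma Spair_factor_right:
  assumes b: "b \<in> Spair S \<alpha> z w" and x: "x \<in> Spair S \<alpha> u w"
  shows "\<exists>a\<in>Spair S \<alpha> u z. x = a O b"
proof -
  obtain i where i: "i \<in> nbh w"
    using nbh_ex[OF w] by blast
  obtain j where j: "j \<in> nbh u" "(j, i) \<in> x"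
    using matching_total(2)[OF Spair_matching[OF u w uw x] i] by blast
  obtain l where l: "l \<in> nbh z" "(l, i) \<in> b"
    using matching_total(2)[OF splitD_Spair_matching(2)[OF u w z b] i] by blast
  obtain a where a: "a \<in> Spair S \<alpha> u z" "(j, l) \<in> a"
    using Spair_cover[OF nondiagD(1)[OF u] splitD_in(2)[OF z] j(1) l(1)] by blast
  have "(j, i) \<in> a O b"
    using l(2) a(2) by blast
  then have "x = a O b"
    using Spair_eqI[OF x Spair_relcomp[OF a(1) b] j(2)] by blast
  then show ?thesis
    using a(1) by blast
qed

end

section \<open>Normal form of the composites and independence of the middle class\<close>

context
  fixes u v w z
  assumes u: "u \<in> nondiag \<Omega> S" and v: "v \<in> nondiag \<Omega> S" and w: "w \<in> splitD \<Omega> S u v"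
    and zu: "z \<in> splitD \<Omega> S u w" and zv: "z \<in> splitD \<Omega> S v w"
begin

text \<open>The right-hand side does not mention \<open>w\<close>. This gives independence of
  \<open>w\<close> when one \<open>z\<close> serves two choices of \<open>w\<close>, and it reduces
  the partition property to that of \<open>Spair S \<alpha> z v\<close>.\<close>

lemma Striple_normal_form:
  assumes a: "a \<in> Spair S \<alpha> u z"
  shows "Striple S \<alpha> u v w = (\<lambda>c. a O c) ` Spair S \<alpha> z v"
proof -
  note wn = splitD_in(1)[OF w]
  note uS = nondiagD(1)[OF u] and vS = nondiagD(1)[OF v]
  note uw = splitD_splits(1)[OF w uS vS] and vw = splitD_splits(2)[OF w uS vS]
  have id: "(a O b) O (b\<inverse> O c) = a O c" if b: "b \<in> Spair S \<alpha> z w"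
    for b and c :: "('a \<times> 'a) set"
  proof -
    have "(a O b) O (b\<inverse> O c) = (a O (b O b\<inverse>)) O c"
      by (simp add: O_assoc)
    also have "b O b\<inverse> = Id_on (nbh z)"
      using matching_relcomp_converse(1)[OF splitD_Spair_matching(2)[OF u wn zu b]] .
    also have "a O Id_on (nbh z) = a"
      using Spair_subset[OF a] by blast
    finally show ?thesis .
  qed
  show ?thesis
  proof
    show "Striple S \<alpha> u v w \<subseteq> (\<lambda>c. a O c) ` Spair S \<alpha> z v"
    proof
      fix t assume "t \<in> Striple S \<alpha> u v w"
      then obtain x y where x: "x \<in> Spair S \<alpha> u w" and y: "y \<in> Spair S \<alpha> w v" and t: "t = x O y"
        unfolding Striple_def by blast
      obtain b where b: "b \<in> Spair S \<alpha> z w" "x = a O b"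
        using Spair_factor_left[OF u wn uw zu a x] by blast
      \<comment> \<open>The assumption \<open>zv\<close> concerns matchings from
        \<open>nbh v\<close> to \<open>nbh w\<close>, so it is the converse of \<open>y\<close> that
        is factored, with the same \<open>b\<close> as right factor.\<close>
      obtain c where c: "c \<in> Spair S \<alpha> v z" "y\<inverse> = c O b"
        using Spair_factor_right[OF v wn vw zv b(1) Spair_converse[OF y]] by blast
      have "y = b\<inverse> O c\<inverse>"
        using c(2) by (metis converse_converse converse_relcomp)
      then have "t = a O c\<inverse>"
        using id[OF b(1)] t b(2) by simp
      then show "t \<in> (\<lambda>c. a O c) ` Spair S \<alpha> z v"
        using Spair_converse[OF c(1)] by blast
    qed
    show "(\<lambda>c. a O c) ` Spair S \<alpha> z v \<subseteq> Striple S \<alpha> u v w"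
    proof
      fix t assume "t \<in> (\<lambda>c. a O c) ` Spair S \<alpha> z v"
      then obtain c where c: "c \<in> Spair S \<alpha> z v" "t = a O c"
        by blast
      \<comment> \<open>Any \<open>b\<close> will do: it is inserted together with its converse to
        split \<open>a O c\<close> at \<open>nbh w\<close>.\<close>
      obtain b where b: "b \<in> Spair S \<alpha> z w"
        using Spair_nonempty[OF splitD_in(1)[OF zu] wn] by blast
      have "c\<inverse> O b \<in> Spair S \<alpha> v w"
        using Spair_relcomp[OF v wn vw zv Spair_converse[OF c(1)] b] .
      then have "b\<inverse> O c \<in> Spair S \<alpha> w v"
        using Spair_converse by (metis converse_converse converse_relcomp)
      then have "(a O b) O (b\<inverse> O c) \<in> Striple S \<alpha> u v w"
        using Spair_relcomp[OF u wn uw zu a b] unfolding Striple_def by blast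
      then show "t \<in> Striple S \<alpha> u v w"
        using id[OF b] c(2) by simp
    qed
  qed
qed

text \<open>Composition on the left with the fixed bijection \<open>a\<close> carries the partition
  \<open>Spair S \<alpha> z v\<close> of \<open>nbh z \<times> nbh v\<close> to the desired
  one.\<close>

lemma Striple_partition: "is_partition_of (nbh u \<times> nbh v) (Striple S \<alpha> u v w)"
proof -
  note wn = splitD_in(1)[OF w]
  obtain a where a: "a \<in> Spair S \<alpha> u z"
    using Spair_nonempty[OF u splitD_in(1)[OF zu]] by blast
  have ma: "matching a (nbh u) (nbh z)"
    using splitD_Spair_matching(1)[OF u wn zu a] .
  have mc: "matching c (nbh z) (nbh v)" if "c \<in> Spair S \<alpha> z v" for c
    using matching_converse[OF splitD_Spair_matching(1)[OF v wn zv Spair_converse[OF that]]]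
    by simp
  have mac: "matching (a O c) (nbh u) (nbh v)" if "c \<in> Spair S \<alpha> z v" for c
    using matching_relcomp[OF ma mc[OF that]] .
  show ?thesis
    unfolding Striple_normal_form[OF a] is_partition_of_def
  proof (intro conjI ballI impI)
    fix s assume "s \<in> (\<lambda>c. a O c) ` Spair S \<alpha> z v"
    then show "s \<noteq> {}"
      using matching_total(1)[OF mac] nbh_ex[OF u] by blast
  next
    show "\<Union>((\<lambda>c. a O c) ` Spair S \<alpha> z v) = nbh u \<times> nbh v"
    proof
      show "\<Union>((\<lambda>c. a O c) ` Spair S \<alpha> z v) \<subseteq> nbh u \<times> nbh v"
        using matching_subset[OF mac] by blast
      show "nbh u \<times> nbh v \<subseteq> \<Union>((\<lambda>c. a O c) ` Spair S \<alpha> z v)"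
      proof
        fix p assume "p \<in> nbh u \<times> nbh v"
        then obtain i j where p: "p = (i, j)" "i \<in> nbh u" "j \<in> nbh v"
          by blast
        obtain l where l: "l \<in> nbh z" "(i, l) \<in> a"
          using matching_total(1)[OF ma p(2)] by blast
        obtain c where "c \<in> Spair S \<alpha> z v" "(l, j) \<in> c"
          using Spair_cover[OF splitD_in(2)[OF zu] nondiagD(1)[OF v] l(1) p(3)] by blast
        then show "p \<in> \<Union>((\<lambda>c. a O c) ` Spair S \<alpha> z v)"
          using l(2) p(1) by blast
      qed
    qed
  next
    fix s t assume s: "s \<in> (\<lambda>c. a O c) ` Spair S \<alpha> z v" and t: "t \<in> (\<lambda>c. a O c) ` Spair S \<alpha> z v"
      and ne: "s \<noteq> t"
    obtain c d where c: "c \<in> Spair S \<alpha> z v" "s = a O c" and d: "d \<in> Spair S \<alpha> z v" "t = a O d"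
      using s t by blast
    have False if st: "(i, j) \<in> s" "(i, j) \<in> t" for i j
    proof -
      obtain l l' where l: "(i, l) \<in> a" "(l, j) \<in> c" "(i, l') \<in> a" "(l', j) \<in> d"
        using c(2) d(2) st by blast
      then have "l' = l"
        using matching_unique(1)[OF ma] by blast
      then have "c = d"
        using Spair_eqI[OF c(1) d(1)] l by blast
      then show False
        using ne c(2) d(2) by simp
    qed
    then show "s \<inter> t = {}"
      by auto
  qed
qed

end

lemma Striple_matching:
  assumes "u \<in> nondiag \<Omega> S" "v \<in> nondiag \<Omega> S" "w \<in> splitD \<Omega> S u v" "t \<in> Striple S \<alpha> u v w"
  shows "matching t (nbh u) (nbh v)"
  using assms(4) matching_relcomp splitD_Spair_matching[OF assms(1-3)] unfolding Striple_def by blast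

end


section \<open>The point extension\<close>

locale splitting_scheme = equivalenced_pointed_scheme +
  assumes A: "\<And>u v. u \<in> nondiag \<Omega> S \<Longrightarrow> v \<in> nondiag \<Omega> S \<Longrightarrow> condA \<Omega> S u v"
    and B: "\<And>u v w. u \<in> nondiag \<Omega> S \<Longrightarrow> v \<in> nondiag \<Omega> S \<Longrightarrow> w \<in> nondiag \<Omega> S \<Longrightarrow> condB \<Omega> S u v w"
begin

text \<open>The choice of \<open>w\<close> is literally the one in \<open>S0\<close>;
  \<open>block_eq\<close> allows later arguments to replace it by whichever splitting class is
  convenient.\<close>

definition block :: "('a \<times> 'a) set \<Rightarrow> ('a \<times> 'a) set \<Rightarrow> ('a \<times> 'a) set set" where
  "block u v = Striple S \<alpha> u v (SOME w. w \<in> splitD \<Omega> S u v)"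

lemma common_splitting:
  assumes "u \<in> nondiag \<Omega> S" "v \<in> nondiag \<Omega> S" "w \<in> nondiag \<Omega> S"
  shows "\<exists>z. z \<in> splitD \<Omega> S u v \<and> z \<in> splitD \<Omega> S v w \<and> z \<in> splitD \<Omega> S w u"
  using B[OF assms] unfolding condB_def by blast

lemma common_splitting_pairs:
  assumes "u \<in> nondiag \<Omega> S" "v \<in> nondiag \<Omega> S" "w \<in> splitD \<Omega> S u v" "w' \<in> splitD \<Omega> S u v"
  shows "\<exists>z. z \<in> splitD \<Omega> S u w \<and> z \<in> splitD \<Omega> S u w' \<and> z \<in> splitD \<Omega> S v w \<and> z \<in> splitD \<Omega> S v w'"
proof -
  have "(\<Inter>a\<in>{u, v}. \<Inter>b\<in>{w, w'}. splitD \<Omega> S a b) \<noteq> {}"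
    using A[OF assms(1,2)] assms(3,4) unfolding condA_def by simp
  then show ?thesis
    by auto
qed

lemma Striple_independent:
  assumes u: "u \<in> nondiag \<Omega> S" and v: "v \<in> nondiag \<Omega> S"
    and w: "w \<in> splitD \<Omega> S u v" and w': "w' \<in> splitD \<Omega> S u v"
  shows "Striple S \<alpha> u v w = Striple S \<alpha> u v w'"
proof -
  obtain z where z: "z \<in> splitD \<Omega> S u w" "z \<in> splitD \<Omega> S u w'"
    "z \<in> splitD \<Omega> S v w" "z \<in> splitD \<Omega> S v w'"
    using common_splitting_pairs[OF u v w w'] by blast
  obtain a where "a \<in> Spair S \<alpha> u z"
    using Spair_nonempty[OF u splitD_in(1)[OF z(1)]] by blast
  then show ?thesis
    using Striple_normal_form[OF u v w z(1,3)] Striple_normal_form[OF u v w' z(2,4)] by simp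
qed

lemma block_eq:
  assumes "u \<in> nondiag \<Omega> S" "v \<in> nondiag \<Omega> S" "w \<in> splitD \<Omega> S u v"
  shows "block u v = Striple S \<alpha> u v w"
  unfolding block_def using Striple_independent[OF assms(1,2) someI assms(3)] assms(3) .

lemma block_partition:
  assumes u: "u \<in> nondiag \<Omega> S" and v: "v \<in> nondiag \<Omega> S"
  shows "is_partition_of (nbh u \<times> nbh v) (block u v)"
proof -
  obtain w where w: "w \<in> splitD \<Omega> S u v"
    using common_splitting[OF u v v] by blast
  obtain z where "z \<in> splitD \<Omega> S u w" "z \<in> splitD \<Omega> S v w"
    using common_splitting_pairs[OF u v w w] by blast
  then show ?thesis
    using Striple_partition[OF u v w] block_eq[OF u v w] by simp
qed

lemma block_matching:
  assumes "u \<in> nondiag \<Omega> S" "v \<in> nondiag \<Omega> S" "t \<in> block u v"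
  shows "matching t (nbh u) (nbh v)"
proof -
  obtain w where w: "w \<in> splitD \<Omega> S u v"
    using common_splitting[OF assms(1,2,2)] by blast
  show ?thesis
    using Striple_matching[OF assms(1,2) w] block_eq[OF assms(1,2) w] assms(3) by simp
qed

text \<open>Condition (B) for \<open>u, v, u\<close> gives one \<open>w\<close> in both \<open>D(u,v)\<close> and \<open>D(v,u)\<close>, so the symmetry of
  \<open>D\<close> need not be proved.\<close>

lemma block_converse:
  assumes u: "u \<in> nondiag \<Omega> S" and v: "v \<in> nondiag \<Omega> S" and t: "t \<in> block u v"
  shows "t\<inverse> \<in> block v u"
proof -
  obtain w where w: "w \<in> splitD \<Omega> S u v" "w \<in> splitD \<Omega> S v u"
    using common_splitting[OF u v u] by blast
  obtain x y where x: "x \<in> Spair S \<alpha> u w" and y: "y \<in> Spair S \<alpha> w v" and t: "t = x O y"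
    using t unfolding block_eq[OF u v w(1)] Striple_def by blast
  have "y\<inverse> O x\<inverse> \<in> Striple S \<alpha> v u w"
    using Spair_converse[OF x] Spair_converse[OF y] unfolding Striple_def by blast
  then show ?thesis
    using t block_eq[OF v u w(2)] by (simp add: converse_relcomp)
qed

lemma block_diag:
  assumes u: "u \<in> nondiag \<Omega> S"
  shows "Id_on (nbh u) \<in> block u u"
proof -
  obtain w where w: "w \<in> splitD \<Omega> S u u"
    using common_splitting[OF u u u] by blast
  obtain x where x: "x \<in> Spair S \<alpha> u w"
    using Spair_nonempty[OF u splitD_in(1)[OF w]] by blast
  have "x O x\<inverse> \<in> block u u"
    using x Spair_converse[OF x] unfolding block_eq[OF u u w] Striple_def by blast
  then show ?thesis
    using matching_relcomp_converse(1)[OF splitD_Spair_matching(1)[OF u u w x]] by simp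
qed

text \<open>As for \<open>Spair\<close>, a factor fitted to one edge suffices, since members of
  \<open>block u v\<close> that share an edge are equal.\<close>

lemma block_factor:
  assumes u: "u \<in> nondiag \<Omega> S" and v: "v \<in> nondiag \<Omega> S" and w: "w \<in> splitD \<Omega> S u v"
    and t: "t \<in> block u v" and q: "q \<in> Spair S \<alpha> w v"
  shows "\<exists>p\<in>Spair S \<alpha> u w. t = p O q"
proof -
  obtain i where i: "i \<in> nbh v"
    using nbh_ex[OF v] by blast
  obtain j where j: "j \<in> nbh u" "(j, i) \<in> t"
    using matching_total(2)[OF block_matching[OF u v t] i] by blast
  obtain l where l: "l \<in> nbh w" "(l, i) \<in> q"
    using matching_total(2)[OF splitD_Spair_matching(2)[OF u v w q] i] by blast
  obtain p where p: "p \<in> Spair S \<alpha> u w" "(j, l) \<in> p"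
    using Spair_cover[OF nondiagD(1)[OF u] splitD_in(2)[OF w] j(1) l(1)] by blast
  have "p O q \<in> block u v"
    using p(1) q unfolding block_eq[OF u v w] Striple_def by blast
  moreover have "(j, i) \<in> p O q"
    using p(2) l(2) by blast
  ultimately have "t = p O q"
    using partition_eqI[OF block_partition[OF u v] t _ j(2)] by blast
  then show ?thesis
    using p(1) by blast
qed

lemma block_relcomp:
  assumes u: "u \<in> nondiag \<Omega> S" and v: "v \<in> nondiag \<Omega> S" and w: "w \<in> nondiag \<Omega> S"
    and x: "x \<in> block u v" and y: "y \<in> block v w"
  shows "x O y \<in> block u w"
proof -
  obtain z where z: "z \<in> splitD \<Omega> S u v" "z \<in> splitD \<Omega> S v w" "z \<in> splitD \<Omega> S w u"
    using common_splitting[OF u v w] by blast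
  obtain q r where q: "q \<in> Spair S \<alpha> v z" and r: "r \<in> Spair S \<alpha> z w" and yqr: "y = q O r"
    using y unfolding block_eq[OF v w z(2)] Striple_def by blast
  \<comment> \<open>Prescribing the converse of the first factor of \<open>y\<close> as right factor
    of \<open>x\<close> makes the two middle factors cancel.\<close>
  obtain p where p: "p \<in> Spair S \<alpha> u z" "x = p O q\<inverse>"
    using block_factor[OF u v z(1) x Spair_converse[OF q]] by blast
  have "x O y = (p O (q\<inverse> O q)) O r"
    using p(2) yqr by (simp add: O_assoc)
  also have "q\<inverse> O q = Id_on (nbh z)"
    using matching_relcomp_converse(2)[OF splitD_Spair_matching(1)[OF v w z(2) q]] .
  also have "p O Id_on (nbh z) = p"
    using Spair_subset[OF p(1)] by blast
  finally have xy: "x O y = p O r" .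
  \<comment> \<open>Condition (B) supplies \<open>z\<close> in \<open>D(w,u)\<close> rather than
    \<open>D(u,w)\<close>, so the product is recognised as a block in the opposite direction and
    then reversed.\<close>
  have "r\<inverse> O p\<inverse> \<in> block w u"
    using Spair_converse[OF p(1)] Spair_converse[OF r]
    unfolding block_eq[OF w u z(3)] Striple_def by blast
  then have "(r\<inverse> O p\<inverse>)\<inverse> \<in> block u w"
    using block_converse[OF w u] by blast
  then show ?thesis
    using xy by (simp add: converse_relcomp)
qed

lemma block_subset_class:
  assumes u: "u \<in> nondiag \<Omega> S" and v: "v \<in> nondiag \<Omega> S" and t: "t \<in> block u v"
  shows "\<exists>p\<in>S. t \<subseteq> p"
proof -
  obtain w where w: "w \<in> splitD \<Omega> S u v"
    using common_splitting[OF u v v] by blast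
  obtain x y where x: "x \<in> Spair S \<alpha> u w" and y: "y \<in> Spair S \<alpha> w v" and txy: "t = x O y"
    using t unfolding block_eq[OF u v w] Striple_def by blast
  obtain b c where bc: "(b, c) \<in> x O y" "b \<in> \<Omega>" "c \<in> \<Omega>"
    using nbh_ex[OF u] matching_total(1)[OF block_matching[OF u v t]] txy
      nbh_subset[OF nondiagD(1)[OF u]] nbh_subset[OF nondiagD(1)[OF v]] by blast
  obtain p where p: "p \<in> S" "(b, c) \<in> p"
    using class_of[OF bc(2,3)] by blast
  have "t \<subseteq> p"
    using Spair_relcomp_subset_class[OF u v w x y p(1) bc(1) p(2)] txy by simp
  then show ?thesis
    using p(1) by blast
qed

section \<open>Assembling the relations on all of \<open>\<Omega>\<close>\<close>

definition cell :: "('a \<times> 'a) set \<Rightarrow> ('a \<times> 'a) set \<Rightarrow> ('a \<times> 'a) set set" where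
  "cell u v = (if u = Id_on \<Omega> \<or> v = Id_on \<Omega> then {nbh u \<times> nbh v} else block u v)"

text \<open>Since \<open>Id_on \<Omega>\<close> has neighbourhood \<open>{\<alpha>}\<close>, index
  pairs that involve it produce \<open>S1\<close> and the remaining pairs produce \<open>S0\<close>.
  A single index set \<open>S \<times> S\<close> then covers all of
  \<open>\<Omega> \<times> \<Omega>\<close>.\<close>

definition ext :: "('a \<times> 'a) set set" where
  "ext = (\<Union>u\<in>S. \<Union>v\<in>S. cell u v)"

lemma cell_cases:
  assumes "t \<in> cell u v" "u \<in> S" "v \<in> S"
  obtains "u = Id_on \<Omega>" "t = nbh u \<times> nbh v"
  | "v = Id_on \<Omega>" "t = nbh u \<times> nbh v"
  | "u \<in> nondiag \<Omega> S" "v \<in> nondiag \<Omega> S" "t \<in> block u v"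
  using assms unfolding cell_def nondiag_def by (auto split: if_splits)

lemma extE:
  assumes "t \<in> ext"
  obtains u v where "u \<in> S" "v \<in> S" "t \<in> cell u v"
  using assms unfolding ext_def by auto

lemma extI: "u \<in> S \<Longrightarrow> v \<in> S \<Longrightarrow> t \<in> cell u v \<Longrightarrow> t \<in> ext"
  unfolding ext_def by auto

lemma cell_partition:
  assumes "u \<in> S" "v \<in> S"
  shows "is_partition_of (nbh u \<times> nbh v) (cell u v)"
proof (cases "u = Id_on \<Omega> \<or> v = Id_on \<Omega>")
  case True
  then show ?thesis
    using nbh_nonempty[OF assms(1) point] nbh_nonempty[OF assms(2) point]
    unfolding cell_def is_partition_of_def by auto
next
  case False
  then show ?thesis
    using block_partition[of u v] assms unfolding cell_def nondiag_def by simp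
qed

lemma cell_subset: "t \<in> cell u v \<Longrightarrow> u \<in> S \<Longrightarrow> v \<in> S \<Longrightarrow> t \<subseteq> nbh u \<times> nbh v"
  using partition_subset[OF cell_partition] by simp

lemma cell_unique:
  assumes "u \<in> S" "v \<in> S" "u' \<in> S" "v' \<in> S" "(b, c) \<in> nbh u \<times> nbh v" "(b, c) \<in> nbh u' \<times> nbh v'"
  shows "u = u'" "v = v'"
  using nbh_eqI[OF assms(1,3)] nbh_eqI[OF assms(2,4)] assms(5,6) by auto

lemma ext_eqI:
  assumes "s \<in> ext" "t \<in> ext" "(b, c) \<in> s" "(b, c) \<in> t"
  shows "s = t"
proof -
  obtain u v where s: "u \<in> S" "v \<in> S" "s \<in> cell u v"
    using assms(1) by (rule extE)
  obtain u' v' where t: "u' \<in> S" "v' \<in> S" "t \<in> cell u' v'"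
    using assms(2) by (rule extE)
  have "(b, c) \<in> nbh u \<times> nbh v" "(b, c) \<in> nbh u' \<times> nbh v'"
    using cell_subset[OF s(3,1,2)] cell_subset[OF t(3,1,2)] assms(3,4) by blast+
  then have "u = u'" "v = v'"
    using cell_unique[OF s(1,2) t(1,2)] by simp_all
  then show ?thesis
    using partition_eqI[OF cell_partition[OF s(1,2)] s(3) _ assms(3,4)] t(3) by simp
qed

lemma ext_partition: "is_partition_of (\<Omega> \<times> \<Omega>) ext"
  unfolding is_partition_of_def
proof (intro conjI ballI impI)
  fix s assume s: "s \<in> ext"
  then obtain u v where uv: "u \<in> S" "v \<in> S" "s \<in> cell u v"
    by (rule extE)
  then show "s \<noteq> {}"
    using partition_nonempty[OF cell_partition] by blast
  fix t assume "t \<in> ext" "s \<noteq> t"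
  then show "s \<inter> t = {}"
    using ext_eqI[OF s] by auto
next
  show "\<Union>ext = \<Omega> \<times> \<Omega>"
  proof
    show "\<Union>ext \<subseteq> \<Omega> \<times> \<Omega>"
    proof
      fix p assume "p \<in> \<Union>ext"
      then obtain t where "t \<in> ext" and p: "p \<in> t"
        by blast
      then obtain u v where "u \<in> S" "v \<in> S" "t \<in> cell u v"
        by (meson extE)
      then show "p \<in> \<Omega> \<times> \<Omega>"
        using cell_subset[of t u v] nbh_subset[of u] nbh_subset[of v] p by blast
    qed
    show "\<Omega> \<times> \<Omega> \<subseteq> \<Union>ext"
    proof
      fix p assume "p \<in> \<Omega> \<times> \<Omega>"
      then obtain b c where p: "p = (b, c)" "b \<in> \<Omega>" "c \<in> \<Omega>"
        by blast
      obtain u where u: "u \<in> S" "b \<in> nbh u"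
        using nbh_cover[OF p(2)] by blast
      obtain v where v: "v \<in> S" "c \<in> nbh v"
        using nbh_cover[OF p(3)] by blast
      have "(b, c) \<in> nbh u \<times> nbh v"
        using u(2) v(2) by blast
      then obtain t where "t \<in> cell u v" "p \<in> t"
        using partition_cover[OF cell_partition[OF u(1) v(1)]] p(1) by blast
      then show "p \<in> \<Union>ext"
        using extI[OF u(1) v(1)] by blast
    qed
  qed
qed

lemma ext_eq: "ext = S0 \<Omega> S \<alpha> \<union> S1 S \<alpha>"
proof
  show "ext \<subseteq> S0 \<Omega> S \<alpha> \<union> S1 S \<alpha>"
  proof
    fix t assume "t \<in> ext"
    then obtain u v where uv: "u \<in> S" "v \<in> S" "t \<in> cell u v"
      by (rule extE)
    from uv(3,1,2) show "t \<in> S0 \<Omega> S \<alpha> \<union> S1 S \<alpha>"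
    proof (cases rule: cell_cases)
      case 1
      then show ?thesis
        using uv(2) nbh_diag unfolding S1_def by auto
    next
      case 2
      then show ?thesis
        using uv(1) nbh_diag unfolding S1_def by auto
    next
      case 3
      then show ?thesis
        unfolding S0_def block_def by blast
    qed
  qed
  show "S0 \<Omega> S \<alpha> \<union> S1 S \<alpha> \<subseteq> ext"
  proof
    fix t assume "t \<in> S0 \<Omega> S \<alpha> \<union> S1 S \<alpha>"
    then consider (block) u v where "u \<in> nondiag \<Omega> S" "v \<in> nondiag \<Omega> S" "t \<in> block u v"
      | (row) v where "v \<in> S" "t = {\<alpha>} \<times> nbh v"
      | (col) v where "v \<in> S" "t = nbh v \<times> {\<alpha>}"
      unfolding S0_def S1_def block_def by blast
    then show "t \<in> ext"
    proof cases
      case block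
      then show ?thesis
        using extI[of u v t] unfolding cell_def nondiag_def by simp
    next
      case row
      then show ?thesis
        using extI[OF diag_in row(1), of t] nbh_diag unfolding cell_def by simp
    next
      case col
      then show ?thesis
        using extI[OF col(1) diag_in, of t] nbh_diag unfolding cell_def by simp
    qed
  qed
qed

lemma cell_total:
  assumes "t \<in> cell u v" "u \<in> S" "v \<in> S"
  shows "Domain t = nbh u" "Range t = nbh v"
proof -
  have "Domain t = nbh u \<and> Range t = nbh v"
    using assms
  proof (cases rule: cell_cases)
    case 3
    then show ?thesis
      using block_matching unfolding matching_def by blast
  qed (use nbh_nonempty[OF assms(2) point] nbh_nonempty[OF assms(3) point] in auto)
  then show "Domain t = nbh u" "Range t = nbh v"
    by simp_all
qed

lemma ext_converse:
  assumes "t \<in> ext"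
  shows "t\<inverse> \<in> ext"
proof -
  obtain u v where uv: "u \<in> S" "v \<in> S" "t \<in> cell u v"
    using assms by (rule extE)
  have "t\<inverse> \<in> cell v u"
  proof (cases "u = Id_on \<Omega> \<or> v = Id_on \<Omega>")
    case True
    then show ?thesis
      using uv(3) unfolding cell_def by auto
  next
    case False
    then show ?thesis
      using uv block_converse[of u v t] unfolding cell_def nondiag_def by simp
  qed
  then show ?thesis
    using extI uv(1,2) by blast
qed

lemma ext_diag:
  assumes "u \<in> S"
  shows "Id_on (nbh u) \<in> ext"
proof -
  have "Id_on (nbh u) \<in> cell u u"
  proof (cases "u = Id_on \<Omega>")
    case True
    then show ?thesis
      using nbh_diag unfolding cell_def by auto
  next
    case False
    then show ?thesis
      using block_diag[of u] assms unfolding cell_def nondiag_def by simp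
  qed
  then show ?thesis
    using extI assms by blast
qed

lemma ext_subset_class:
  assumes "t \<in> ext"
  shows "\<exists>p\<in>S. t \<subseteq> p"
proof -
  obtain u v where uv: "u \<in> S" "v \<in> S" "t \<in> cell u v"
    using assms by (rule extE)
  from uv(3,1,2) show ?thesis
  proof (cases rule: cell_cases)
    case 1
    then have "t \<subseteq> v"
      using nbh_diag by auto
    then show ?thesis
      using uv(2) by blast
  next
    case 2
    then have "t \<subseteq> u\<inverse>"
      using nbh_diag by auto
    then show ?thesis
      using conv[OF uv(1)] by blast
  next
    case 3
    then show ?thesis
      by (rule block_subset_class)
  qed
qed

section \<open>Composition and intersection numbers\<close>

lemma cell_relcomp:
  assumes u: "u \<in> S" and v: "v \<in> S" and w: "w \<in> S" and r: "r \<in> cell u v" and s: "s \<in> cell v w"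
  shows "r O s \<in> cell u w \<or> r O s = nbh u \<times> nbh w"
proof -
  consider (mid) "v = Id_on \<Omega>" | (left) "v \<noteq> Id_on \<Omega>" "u = Id_on \<Omega>" | (right) "v \<noteq> Id_on \<Omega>" "w = Id_on \<Omega>"
    | (none) "u \<noteq> Id_on \<Omega>" "v \<noteq> Id_on \<Omega>" "w \<noteq> Id_on \<Omega>"
    by blast
  then show ?thesis
  proof cases
    case mid
    \<comment> \<open>Passing through \<open>\<alpha>\<close> gives the full rectangle, in general a
      union of several cells; hence the second alternative in the statement.\<close>
    then have "r = nbh u \<times> {\<alpha>}" "s = {\<alpha>} \<times> nbh w"
      using r s nbh_diag unfolding cell_def by auto
    then show ?thesis
      by auto
  next
    case left
    then have "r = nbh u \<times> nbh v"
      using r unfolding cell_def by auto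
    then have "r O s = nbh u \<times> nbh w"
      using cell_total[OF s v w] by blast
    then show ?thesis ..
  next
    case right
    then have "s = nbh v \<times> nbh w"
      using s unfolding cell_def by auto
    then have "r O s = nbh u \<times> nbh w"
      using cell_total[OF r u v] by blast
    then show ?thesis ..
  next
    case none
    then show ?thesis
      using block_relcomp[of u v w r s] u v w r s unfolding cell_def nondiag_def by simp
  qed
qed

lemma cell_single_valued:
  assumes "u \<in> S" "v \<in> S" "t \<in> cell u v"
  shows "u \<noteq> Id_on \<Omega> \<or> v = Id_on \<Omega> \<Longrightarrow> single_valued t"
    and "v \<noteq> Id_on \<Omega> \<or> u = Id_on \<Omega> \<Longrightarrow> single_valued (t\<inverse>)"
proof -
  have "single_valued t \<and> single_valued (t\<inverse>)" if "u \<noteq> Id_on \<Omega>" "v \<noteq> Id_on \<Omega>"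
    using block_matching[of u v t] assms that unfolding cell_def nondiag_def matching_def by simp
  moreover have "single_valued t" if "v = Id_on \<Omega>"
    using assms(3) that nbh_diag unfolding cell_def single_valued_def by auto
  moreover have "single_valued (t\<inverse>)" if "u = Id_on \<Omega>"
    using assms(3) that nbh_diag unfolding cell_def single_valued_def by auto
  ultimately show "u \<noteq> Id_on \<Omega> \<or> v = Id_on \<Omega> \<Longrightarrow> single_valued t"
    and "v \<noteq> Id_on \<Omega> \<or> u = Id_on \<Omega> \<Longrightarrow> single_valued (t\<inverse>)"
    by blast+
qed

lemma card_middle_single_valued:
  assumes "single_valued r \<or> single_valued (s\<inverse>)" "(a, c) \<in> r O s"
  shows "card {b. (a, b) \<in> r \<and> (b, c) \<in> s} = 1"
proof -
  obtain b where b: "(a, b) \<in> r" "(b, c) \<in> s"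
    using assms(2) by blast
  then have "{b. (a, b) \<in> r \<and> (b, c) \<in> s} = {b}"
    using assms(1) unfolding single_valued_def by auto
  then show ?thesis
    by simp
qed

text \<open>The middle point is unique, so both counts are 1, except when walks leave
  \<open>\<alpha>\<close> for a nondiagonal neighbourhood and return. In that case
  \<open>(\<alpha>, \<alpha>)\<close> is the only pair to compare.\<close>

lemma cell_card_eq:
  assumes u: "u \<in> S" and v: "v \<in> S" and w: "w \<in> S" and r: "r \<in> cell u v" and s: "s \<in> cell v w"
    and ac: "(a, c) \<in> r O s" "(a', c') \<in> r O s"
  shows "card {b. (a, b) \<in> r \<and> (b, c) \<in> s} = card {b. (a', b) \<in> r \<and> (b, c') \<in> s}"
proof (cases "u = Id_on \<Omega> \<and> w = Id_on \<Omega> \<and> v \<noteq> Id_on \<Omega>")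
  case True
  have "r O s \<subseteq> nbh u \<times> nbh w"
    using cell_subset[OF r u v] cell_subset[OF s v w] by blast
  then have "r O s \<subseteq> {(\<alpha>, \<alpha>)}"
    using True nbh_diag by auto
  then show ?thesis
    using ac by blast
next
  case False
  then have "single_valued r \<or> single_valued (s\<inverse>)"
    using cell_single_valued(1)[OF u v r] cell_single_valued(2)[OF v w s] by blast
  then show ?thesis
    using card_middle_single_valued[OF _ ac(1)] card_middle_single_valued[OF _ ac(2)] by simp
qed

text \<open>Neighbourhoods of distinct classes are disjoint, so the common point \<open>p\<close>
  forces the indices of \<open>r\<close>, \<open>s\<close> and \<open>t\<close> to match. Both
  claims then concern fixed cells.\<close>

lemma ext_relcomp_saturated:
  assumes r: "r \<in> ext" and s: "s \<in> ext" and t: "t \<in> ext" and p: "p \<in> t" "p \<in> r O s"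
  shows "t \<subseteq> r O s"
    and "x \<in> r O s \<Longrightarrow> y \<in> r O s \<Longrightarrow> card {b. (fst x, b) \<in> r \<and> (b, snd x) \<in> s} =
        card {b. (fst y, b) \<in> r \<and> (b, snd y) \<in> s}"
proof -
  obtain u v where uv: "u \<in> S" "v \<in> S" "r \<in> cell u v"
    using r by (rule extE)
  obtain v' w where vw: "v' \<in> S" "w \<in> S" "s \<in> cell v' w"
    using s by (rule extE)
  obtain u'' w'' where uw: "u'' \<in> S" "w'' \<in> S" "t \<in> cell u'' w''"
    using t by (rule extE)
  obtain a b c where abc: "p = (a, c)" "(a, b) \<in> r" "(b, c) \<in> s"
    using p(2) by blast
  have nb: "a \<in> nbh u" "b \<in> nbh v" "b \<in> nbh v'" "c \<in> nbh w"
    using abc(2,3) cell_subset[OF uv(3,1,2)] cell_subset[OF vw(3,1,2)] by blast+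
  then have [simp]: "v' = v"
    using nbh_eqI uv(2) vw(1) by blast
  have s': "s \<in> cell v w"
    using vw(3) by simp
  have "a \<in> nbh u''" "c \<in> nbh w''"
    using p(1) abc(1) cell_subset[OF uw(3,1,2)] by blast+
  then have [simp]: "u'' = u" "w'' = w"
    using nb nbh_eqI uv(1) vw(2) uw(1,2) by blast+
  have "r O s \<in> cell u w \<or> r O s = nbh u \<times> nbh w"
    using cell_relcomp[OF uv(1,2) vw(2) uv(3) s'] .
  then show "t \<subseteq> r O s"
  proof
    assume "r O s \<in> cell u w"
    then have "t = r O s"
      using partition_eqI[OF cell_partition[OF uv(1) vw(2)], of t "r O s" p] uw(3) p by simp
    then show ?thesis
      by simp
  next
    assume "r O s = nbh u \<times> nbh w"
    then show ?thesis
      using cell_subset[OF uw(3,1,2)] by simp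
  qed
  show "card {b. (fst x, b) \<in> r \<and> (b, snd x) \<in> s} = card {b. (fst y, b) \<in> r \<and> (b, snd y) \<in> s}"
    if "x \<in> r O s" "y \<in> r O s"
    using cell_card_eq[OF uv(1,2) vw(2) uv(3) s', of "fst x" "snd x" "fst y" "snd y"] that by simp
qed

lemma ext_coherent: "coherent_config \<Omega> ext"
  unfolding coherent_config_def
proof (intro conjI ballI)
  show "finite \<Omega>" by (rule fin)
  show "is_partition_of (\<Omega> \<times> \<Omega>) ext" by (rule ext_partition)
  show "r\<inverse> \<in> ext" if "r \<in> ext" for r
    using ext_converse[OF that] .
  have "\<Union>((\<lambda>u. Id_on (nbh u)) ` S) = Id_on \<Omega>"
    using nbh_cover nbh_subset by fast
  then show "union_of (Id_on \<Omega>) ext"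
    using ext_diag unfolding union_of_def by (intro exI[of _ "(\<lambda>u. Id_on (nbh u)) ` S"]) auto
next
  fix r s t x y assume h: "r \<in> ext" "s \<in> ext" "t \<in> ext" "x \<in> t" "y \<in> t"
  show "card {b. (fst x, b) \<in> r \<and> (b, snd x) \<in> s} = card {b. (fst y, b) \<in> r \<and> (b, snd y) \<in> s}"
  proof (cases "x \<in> r O s \<or> y \<in> r O s")
    case True
    then obtain p where p: "p \<in> t" "p \<in> r O s"
      using h by blast
    then have "x \<in> r O s" "y \<in> r O s"
      using ext_relcomp_saturated(1)[OF h(1-3) p] h(4,5) by blast+
    then show ?thesis
      by (rule ext_relcomp_saturated(2)[OF h(1-3) p])
  next
    case False
    then have "{b. (fst x, b) \<in> r \<and> (b, snd x) \<in> s} = {}" "{b. (fst y, b) \<in> r \<and> (b, snd y) \<in> s} = {}"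
      by (metis (no_types, lifting) Collect_empty_eq prod.collapse relcomp.relcompI)+
    then show ?thesis
      by (simp only:)
  qed
qed

lemma ext_candidate: "is_alpha_ext_candidate \<Omega> S \<alpha> ext"
  unfolding is_alpha_ext_candidate_def
proof (intro conjI ballI)
  show "coherent_config \<Omega> ext" by (rule ext_coherent)
  have "Id_on (nbh (Id_on \<Omega>)) = {(\<alpha>, \<alpha>)}"
    using nbh_diag by auto
  then show "union_of {(\<alpha>, \<alpha>)} ext"
    using union_of_member[OF ext_diag[OF diag_in]] by simp
  fix s assume s: "s \<in> S"
  show "union_of s ext"
  proof (rule union_ofI[OF ext_partition])
    show "s \<subseteq> \<Omega> \<times> \<Omega>"
      using partition_subset[OF part s] .
    fix t p assume t: "t \<in> ext" "p \<in> t" "p \<in> s"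
    obtain q where q: "q \<in> S" "t \<subseteq> q"
      using ext_subset_class[OF t(1)] by blast
    then have "q = s"
      using partition_eqI[OF part q(1) s, of p] t(2,3) by blast
    then show "t \<subseteq> s"
      using q(2) by simp
  qed
qed

section \<open>The extension is coarsest among all candidates\<close>

lemma union_of_nbh_Times:
  assumes T: "is_alpha_ext_candidate \<Omega> S \<alpha> T" and u: "u \<in> S" and v: "v \<in> S"
  shows "union_of (nbh u \<times> nbh v) T"
proof -
  have cc: "coherent_config \<Omega> T" and "union_of {(\<alpha>, \<alpha>)} T" "union_of u T" "union_of v T"
    using T u v unfolding is_alpha_ext_candidate_def by auto
  \<comment> \<open>The rectangle consists of the end points of walks forced through
    \<open>\<alpha>\<close>, which writes it as a composite of unions of classes.\<close>
  then have "union_of ((u\<inverse> O {(\<alpha>, \<alpha>)}) O v) T"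
    by (intro union_of_relcomp[OF cc] union_of_converse[OF cc])
  moreover have "(u\<inverse> O {(\<alpha>, \<alpha>)}) O v = nbh u \<times> nbh v"
    by auto
  ultimately show ?thesis
    by simp
qed

lemma union_of_Spair:
  assumes T: "is_alpha_ext_candidate \<Omega> S \<alpha> T" and u: "u \<in> S" and v: "v \<in> S"
    and x: "x \<in> Spair S \<alpha> u v"
  shows "union_of x T"
proof -
  obtain s where s: "s \<in> S" "x = s \<inter> (nbh u \<times> nbh v)"
    using x unfolding Spair_def cprod_def by blast
  have "coherent_config \<Omega> T" "union_of s T"
    using T s(1) unfolding is_alpha_ext_candidate_def by auto
  then show ?thesis
    using union_of_Int union_of_nbh_Times[OF T u v] s(2) by blast
qed

lemma ext_coarsest:
  assumes T: "is_alpha_ext_candidate \<Omega> S \<alpha> T" and t: "t \<in> ext"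
  shows "union_of t T"
proof -
  obtain u v where uv: "u \<in> S" "v \<in> S" "t \<in> cell u v"
    using t by (rule extE)
  from uv(3,1,2) show ?thesis
  proof (cases rule: cell_cases)
    case 3
    obtain w where w: "w \<in> splitD \<Omega> S u v"
      using common_splitting[OF 3(1,2,2)] by blast
    then obtain x y where xy: "x \<in> Spair S \<alpha> u w" "y \<in> Spair S \<alpha> w v" "t = x O y"
      using 3(3) unfolding block_eq[OF 3(1,2) w] Striple_def by blast
    have "union_of x T" "union_of y T"
      using union_of_Spair[OF T] xy(1,2) uv(1,2) splitD_in(2)[OF w] by blast+
    moreover have "coherent_config \<Omega> T"
      using T unfolding is_alpha_ext_candidate_def by blast
    ultimately show ?thesis
      using union_of_relcomp xy(3) by blast
  qed (use union_of_nbh_Times[OF T uv(1,2)] in simp_all)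
qed

lemma alpha_ext_eq: "alpha_ext \<Omega> S \<alpha> = ext"
proof -
  have ext: "is_alpha_ext \<Omega> S \<alpha> ext"
    using ext_candidate ext_coarsest unfolding is_alpha_ext_def by blast
  show ?thesis
    unfolding alpha_ext_def by (rule the_equality, rule ext) (rule is_alpha_ext_unique[OF _ ext])
qed

section \<open>Semiregularity and fibers\<close>

lemma ext_semiregular: "semiregular_on_minus \<Omega> \<alpha> ext"
  unfolding semiregular_on_minus_def
proof (intro ballI allI impI)
  fix t b assume t: "t \<in> ext" and sub: "t \<subseteq> (\<Omega> - {\<alpha>}) \<times> (\<Omega> - {\<alpha>})"
  obtain u v where uv: "u \<in> S" "v \<in> S" "t \<in> cell u v"
    using t by (rule extE)
  \<comment> \<open>Only the rows \<open>{\<alpha>} \<times> nbh v\<close> can fail to be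
    single-valued, and these start at \<open>\<alpha>\<close>.\<close>
  have "\<alpha> \<notin> Domain t"
    using sub by blast
  then have "u \<noteq> Id_on \<Omega>"
    using cell_total(1)[OF uv(3,1,2)] nbh_diag by auto
  then have "single_valued t"
    using cell_single_valued(1)[OF uv] by blast
  then have "\<exists>c. {c. (b, c) \<in> t} \<subseteq> {c}"
    unfolding single_valued_def by blast
  then show "card {c. (b, c) \<in> t} \<le> 1"
    by (metis card.empty card_1_singleton_iff One_nat_def order_refl subset_singletonD zero_le)
qed

lemma ext_fibers: "fibers ext = nbh ` S"
proof
  show "fibers ext \<subseteq> nbh ` S"
  proof
    fix \<Delta> assume "\<Delta> \<in> fibers ext"
    then have \<Delta>: "Id_on \<Delta> \<in> ext"
      unfolding fibers_def by simp
    then obtain d where d: "d \<in> \<Delta>"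
      using partition_nonempty[OF ext_partition] by fast
    then have "d \<in> \<Omega>"
      using partition_subset[OF ext_partition \<Delta>] by blast
    then obtain u where u: "u \<in> S" "d \<in> nbh u"
      using nbh_cover by blast
    \<comment> \<open>Both diagonals are classes of \<open>ext\<close> and share the pair
      \<open>(d, d)\<close>.\<close>
    have "Id_on \<Delta> = Id_on (nbh u)"
      using ext_eqI[OF \<Delta> ext_diag[OF u(1)], of d d] d u(2) by blast
    then have "\<Delta> = nbh u"
      by (metis Domain_Id_on)
    then show "\<Delta> \<in> nbh ` S"
      using u(1) by simp
  qed
  show "nbh ` S \<subseteq> fibers ext"
    using ext_diag unfolding fibers_def by auto
qed

end

theorem theorem4p4:
  fixes \<Omega> :: "'a set" and S :: "('a \<times> 'a) set set" and \<alpha>0 :: 'a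
  assumes "scheme \<Omega> S"
    and "equivalenced \<Omega> S"
    and "\<forall>u\<in>nondiag \<Omega> S. \<forall>v\<in>nondiag \<Omega> S. condA \<Omega> S u v"
    and "\<forall>u\<in>nondiag \<Omega> S. \<forall>v\<in>nondiag \<Omega> S. \<forall>w\<in>nondiag \<Omega> S. condB \<Omega> S u v w"
    and "\<alpha>0 \<in> \<Omega>"
  shows "alpha_ext \<Omega> S \<alpha>0 = S0 \<Omega> S \<alpha>0 \<union> S1 S \<alpha>0
    \<and> semiregular_on_minus \<Omega> \<alpha>0 (alpha_ext \<Omega> S \<alpha>0)
    \<and> fibers (alpha_ext \<Omega> S \<alpha>0) = (\<lambda>u. u `` {\<alpha>0}) ` S"
proof -
  interpret splitting_scheme \<Omega> S \<alpha>0
    using assms by unfold_locales blast+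
  show ?thesis
    using ext_eq ext_semiregular ext_fibers unfolding alpha_ext_eq by blast
qed

end
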